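(* Let $n\ge 400001$ be odd and $p\in\{0,1\}$. Every $p$-cover $C$ of the $n\times n$ queen's board satisfies $$|C|>\frac{8001}{16000}(n-1)-1 .$$ Moreover, if $C$ contains a square of each of the two long diagonals $Y-X=0$ and $X+Y=0$, then $$|C|>\frac{8001}{16000}(n-1).$$
   Context: For odd $n$, the squares of the $n\times n$ board are the pairs $(X,Y)$ of integers with $|X|,|Y|\le (n-1)/2$ (centered coordinates; $X$ is the column index, $Y$ the row index). A set $C$ of squares (queens) occupies a line if it contains a square of that line. The lines are the columns ($X$ constant), rows ($Y$ constant), difference diagonals ($Y-X$ constant) and sum diagonals ($X+Y$ constant). For $p\in\{0,1\}$, $C$ is $p$-orthodox if every row and every column whose centered index has parity $p$ is occupied. A $p$-orthodox set is a $p$-cover if every square $(X,Y)$ with both $X\equiv Y\equiv 1-p\pmod 2$ lies on an occupied diagonal (difference or sum). Queens may attack one another and may lie on the board boundary. *)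

theory Defs
  imports Complex_Main "HOL-Number_Theory.Cong"
begin

text \<open>
  Squares are pairs \<open>(X, Y)\<close> of centered coordinates, \<open>X\<close> being the column index and \<open>Y\<close> the row
  index. The centering is meant for odd \<open>n\<close>, where \<open>(n - 1) / 2\<close> is an integer and the integer
  division below is exact.
\<close>

type_synonym square = "int \<times> int"

definition indices :: "nat \<Rightarrow> int set" where
  "indices n = {X. \<bar>X\<bar> \<le> (int n - 1) div 2}"

definition board :: "nat \<Rightarrow> square set" where
  "board n = indices n \<times> indices n"

definition column :: "nat \<Rightarrow> int \<Rightarrow> square set" where
  "column n c = {(X, Y) \<in> board n. X = c}"

definition row :: "nat \<Rightarrow> int \<Rightarrow> square set" where
  "row n r = {(X, Y) \<in> board n. Y = r}"

definition diff_diagonal :: "nat \<Rightarrow> int \<Rightarrow> square set" where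
  "diff_diagonal n d = {(X, Y) \<in> board n. Y - X = d}"

definition sum_diagonal :: "nat \<Rightarrow> int \<Rightarrow> square set" where
  "sum_diagonal n s = {(X, Y) \<in> board n. X + Y = s}"

definition occupies :: "square set \<Rightarrow> square set \<Rightarrow> bool" where
  "occupies C L \<longleftrightarrow> C \<inter> L \<noteq> {}"

definition orthodox :: "nat \<Rightarrow> int \<Rightarrow> square set \<Rightarrow> bool" where
  "orthodox n p C \<longleftrightarrow> C \<subseteq> board n \<and>
     (\<forall>k\<in>indices n. [k = p] (mod 2) \<longrightarrow> occupies C (column n k) \<and> occupies C (row n k))"

definition p_cover :: "nat \<Rightarrow> int \<Rightarrow> square set \<Rightarrow> bool" where
  "p_cover n p C \<longleftrightarrow> orthodox n p C \<and>
     (\<forall>(X, Y)\<in>board n. [X = 1 - p] (mod 2) \<and> [Y = 1 - p] (mod 2) \<longrightarrow>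
        occupies C (diff_diagonal n (Y - X)) \<or> occupies C (sum_diagonal n (X + Y)))"

end

theory Submission
  imports Defs
begin

text \<open>
  Put \<open>m = (n - 1) / 2\<close> and \<open>K = |C|\<close>. Orthodoxy alone gives \<open>K \<ge> m\<close>. The proof shows that
  \<open>K \<le> (1 + 1/8000) m\<close> is impossible; both inequalities of the theorem follow from this, since
  \<open>8001/16000 (n - 1) = 8001/8000 m\<close>.

  Describe a queen \<open>(X, Y)\<close> by \<open>a = (Y - X)/2\<close> and \<open>b = (X + Y)/2\<close>. A difference diagonal \<open>2a\<close> and a
  sum diagonal \<open>2b\<close> with \<open>a + b\<close> of parity \<open>1 - p\<close> meet, if at all, in a square that has to be
  covered. So two such unoccupied diagonals meet outside the board, that is \<open>|a| + |b| > m\<close>. Apply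
  this to the shortest gaps: the occupied difference diagonals contain all \<open>a\<close> of parity \<open>e\<close> with
  \<open>|a| < r e\<close>, the occupied sum diagonals contain all \<open>b\<close> with \<open>b + p\<close> of parity \<open>e\<close> and
  \<open>|b| < r e\<close>, and \<open>r even + r odd\<close> is nearly \<open>m\<close>. As there are hardly more queens than lines that
  must be occupied, up to a few exceptional queens everything about the distribution of the
  coordinates is known: \<open>X\<close> and \<open>Y\<close> are equidistributed over the indices of parity \<open>p\<close>, and \<open>a\<close> and
  \<open>b\<close> are, within each parity class, equidistributed over an interval of radius \<open>r e\<close>. Moreover \<open>a\<close>
  and \<open>b + p\<close> have the same parity whenever \<open>X\<close> and \<open>Y\<close> have parity \<open>p\<close>.

  That these distributions are incompatible is shown by linear programming duality. If weight
  functions satisfy \<open>h (u + v) + h |u - v| \<le> \<phi> e u + \<phi> e v\<close>, then summing over the queens, with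
  \<open>u = |a|/m\<close> and \<open>v = |b|/m\<close>, bounds the total of \<open>h\<close> over rows and columns by the total of \<open>\<phi>\<close>
  over the diagonals (\<open>weighted_count\<close>); exceptional diagonals are paid for by a constant \<open>\<Phi>\<close>. Up to
  \<open>O(1/m)\<close> the totals are integrals (\<open>integrated_count\<close>). The parallelogram identity gives
  \<open>h x = x^2\<close> and \<open>h x = 1 - x^2\<close> with equality, and they yield \<open>t^3 + (1 - t)^3 = 1/2\<close> for
  \<open>t = r e / m\<close>, up to a small error. So the smaller ratio is close to \<open>(3 - sqrt 3)/6 = 0.2113...\<close>
  (\<open>smaller_ratio\<close>).

  The contradiction comes from one further weight. For \<open>h x = x\<close> one has
  \<open>h (u + v) + h |u - v| = 2 max u v\<close>, and bounding \<open>max u v\<close> by hinge functions with their corner at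
  half the radius of the class gives, at the critical ratio, exactly \<open>1 \<le> 1\<close>. Equality would force
  every queen to have one of \<open>u\<close>, \<open>v\<close> on either side of that corner, which leaves room for an
  improvement: replacing the line near \<open>0\<close> by the parabola \<open>5/2 x^2\<close> makes the left side larger than
  the right side by about \<open>0.0009\<close>, more than all errors together (\<open>no_small_cover\<close>).
\<close>

section \<open>Sums over a parity class\<close>

definition band :: "bool \<Rightarrow> nat \<Rightarrow> int set" where
  "band e t = {k. \<bar>k\<bar> < int t \<and> even k = e}"

lemma finite_band [simp]: "finite (band e t)"
  by (rule finite_subset[of _ "{- int t..int t}"]) (auto simp: band_def)

lemma band_0 [simp]: "band e 0 = {}"
  by (auto simp: band_def)

lemma band_Suc: "band e (Suc t) = (if even t = e then {int t, - int t} else {}) \<union> band e t"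
proof -
  have "\<bar>k\<bar> < int (Suc t) \<longleftrightarrow> k = int t \<or> k = - int t \<or> \<bar>k\<bar> < int t" for k by auto
  then show ?thesis by (auto simp: band_def)
qed

lemma sum_band_Suc:
  fixes g :: "real \<Rightarrow> real"
  shows "(\<Sum>k\<in>band e (Suc t). g (\<bar>k\<bar> / m)) =
    (\<Sum>k\<in>band e t. g (\<bar>k\<bar> / m)) +
    (if even t = e then (if t = 0 then 1 else 2) * g (t / m) else 0)"
proof -
  have "{int t, - int t} \<inter> band e t = {}" by (auto simp: band_def)
  then show ?thesis
    by (simp add: band_Suc sum.union_disjoint del: Un_insert_left insert_disjoint)
qed

text \<open>
  As \<open>t\<close> grows by one, the band gains two indices at every other step and none at the steps in between.
  Counting one of the two a step early yields a Riemann sum with mesh \<open>1/m\<close>: every step then adds the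
  value of \<open>g\<close> at an endpoint of the new interval, with an error of at most \<open>L/m\<close> by the mean value
  theorem. The early index accounts for the term \<open>|g (t/m)|\<close>.
\<close>

lemma sum_band_approx:
  fixes g G :: "real \<Rightarrow> real" and m t :: nat
  assumes m: "m > 0"
    and deriv: "\<And>x. 0 \<le> x \<Longrightarrow> x \<le> t / m \<Longrightarrow> (G has_real_derivative g x) (at x)"
    and lip: "\<And>x y. 0 \<le> x \<Longrightarrow> x \<le> t / m \<Longrightarrow> 0 \<le> y \<Longrightarrow> y \<le> t / m \<Longrightarrow> \<bar>g x - g y\<bar> \<le> L * \<bar>x - y\<bar>"
    and G0: "G 0 = 0" and L: "0 \<le> L"
  shows "\<bar>(\<Sum>k\<in>band e t. g (\<bar>k\<bar> / m)) - m * G (t / m)\<bar> \<le> L * (t / m) + \<bar>g (t / m)\<bar>"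
proof -
  have step: "\<bar>g (z / m) - m * (G (Suc s / m) - G (s / m))\<bar> \<le> L / m"
    if s: "Suc s \<le> t" and z: "z = s \<or> z = Suc s" for s z :: nat
  proof -
    have lt: "s / m < Suc s / m" using m by (simp add: divide_strict_right_mono)
    have le: "Suc s / m \<le> t / m" using s m by (simp add: divide_right_mono)
    obtain c where c: "s / m < c" "c < Suc s / m" "G (Suc s / m) - G (s / m) = (Suc s / m - s / m) * g c"
    proof -
      have "\<exists>c. s / m < c \<and> c < Suc s / m \<and> G (Suc s / m) - G (s / m) = (Suc s / m - s / m) * g c"
        using lt le by (intro MVT2 deriv) (auto intro: order_trans[OF _ le] order_trans[of 0 "s / m"])
      then show ?thesis using that by blast
    qed
    have d: "Suc s / m - s / m = 1 / m" by (simp add: diff_divide_distrib[symmetric])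
    have c0: "0 \<le> c" "c \<le> t / m" using c le by (auto intro: order_trans[of 0 "s / m"])
    have z0: "0 \<le> z / m" "z / m \<le> t / m" using z s m by (auto intro!: divide_right_mono)
    have "\<bar>g (z / m) - g c\<bar> \<le> L * \<bar>z / m - c\<bar>" using c0 z0 by (intro lip)
    also have "\<bar>z / m - c\<bar> \<le> 1 / m" using z c(1,2) d by auto
    then have "L * \<bar>z / m - c\<bar> \<le> L * (1 / m)" using L by (intro mult_left_mono)
    also have "g c = m * (G (Suc s / m) - G (s / m))" using c(3) d m by simp
    finally show ?thesis by simp
  qed
  \<comment> \<open>Of the next two indices \<open>Suc s\<close> and \<open>- Suc s\<close>, one is counted ahead of time.\<close>
  have main: "\<bar>(\<Sum>k\<in>band e (Suc s). g (\<bar>k\<bar> / m)) - m * G (Suc s / m)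
      + (if even (Suc s) = e then g (Suc s / m) else 0)\<bar> \<le> L * (Suc s / m)"
    if "Suc s \<le> t" for s
    using that
  proof (induction s)
    case 0
    have "L * (Suc 0 / m) = L / m" by simp
    then show ?case using step[of 0 0] step[of 0 1] 0 G0
      unfolding sum_band_Suc by (auto simp: abs_le_iff)
  next
    case (Suc s)
    have e1: "L * (Suc (Suc s) / m) = L * (Suc s / m) + L / m"
      by (simp add: add_divide_distrib algebra_simps)
    have IH: "\<bar>(\<Sum>k\<in>band e (Suc s). g (\<bar>k\<bar> / m)) - m * G (Suc s / m)
      + (if even (Suc s) = e then g (Suc s / m) else 0)\<bar> \<le> L * (Suc s / m)"
      using Suc by simp
    have st: "\<bar>g (Suc s / m) - m * (G (Suc (Suc s) / m) - G (Suc s / m))\<bar> \<le> L / m"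
      "\<bar>g (Suc (Suc s) / m) - m * (G (Suc (Suc s) / m) - G (Suc s / m))\<bar> \<le> L / m"
      using step[of "Suc s" "Suc s"] step[of "Suc s" "Suc (Suc s)"] Suc.prems by auto
    show ?case
    proof (cases "even (Suc s) = e")
      case True
      then have F: "even (Suc (Suc s)) \<noteq> e" by simp
      have S: "(\<Sum>k\<in>band e (Suc (Suc s)). g (\<bar>k\<bar> / m)) =
         (\<Sum>k\<in>band e (Suc s). g (\<bar>k\<bar> / m)) + 2 * g (Suc s / m)"
        using True by (subst sum_band_Suc) simp
      show ?thesis using IH st(1) True F unfolding S e1 right_diff_distrib
        by (simp only: if_True if_False simp_thms)
    next
      case False
      then have F: "even (Suc (Suc s)) = e" by auto
      have S: "(\<Sum>k\<in>band e (Suc (Suc s)). g (\<bar>k\<bar> / m)) =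
         (\<Sum>k\<in>band e (Suc s). g (\<bar>k\<bar> / m))"
        using False by (subst sum_band_Suc) simp
      show ?thesis using IH st(2) False F unfolding S e1 right_diff_distrib
        by (simp only: if_True if_False simp_thms)
    qed
  qed
  show ?thesis
  proof (cases t)
    case 0
    then show ?thesis using G0 by simp
  next
    case (Suc s)
    then show ?thesis using main[of s] by (auto split: if_splits)
  qed
qed

lemma card_band_ge: "t \<le> card (band e t) + 1"
proof -
  have "\<bar>(\<Sum>k\<in>band e t. (1::real)) - real 1 * (t / real 1)\<bar> \<le> 0 * (t / real 1) + \<bar>1\<bar>"
    by (rule sum_band_approx[where g = "\<lambda>_. 1" and G = "\<lambda>x. x" and m = 1]) auto
  then show ?thesis by (simp add: abs_le_iff)
qed

text \<open>
  All piecewise polynomial weights below are linear combinations of truncated powers, which have an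
  antiderivative in closed form without a case distinction.
\<close>

lemma has_real_derivative_trunc_power:
  fixes c x :: real
  shows "((\<lambda>x. max (x - c) 0 ^ Suc (Suc n)) has_real_derivative
           real (Suc (Suc n)) * max (x - c) 0 ^ Suc n) (at x)"
proof -
  consider "x < c" | "x = c" | "x > c" by linarith
  then show ?thesis
  proof cases
    case 1
    have "((\<lambda>x. 0) has_real_derivative 0) (at x)" by simp
    then have "((\<lambda>x. max (x - c) 0 ^ Suc (Suc n)) has_real_derivative 0) (at x)"
      by (rule has_field_derivative_transform_within_open[where S = "{..<c}"]) (use 1 in auto)
    then show ?thesis using 1 by simp
  next
    case 3
    have "((\<lambda>x. x - c) has_real_derivative 1) (at x)" by (auto intro!: derivative_eq_intros)
    from DERIV_power[OF this, of "Suc (Suc n)"]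
    have "((\<lambda>x. (x - c) ^ Suc (Suc n)) has_real_derivative real (Suc (Suc n)) * (x - c) ^ Suc n) (at x)"
      by (simp only: mult_1 diff_Suc_Suc diff_zero One_nat_def)
    then have "((\<lambda>x. max (x - c) 0 ^ Suc (Suc n)) has_real_derivative real (Suc (Suc n)) * (x - c) ^ Suc n) (at x)"
      by (rule has_field_derivative_transform_within_open[where S = "{c<..}"]) (use 3 in auto)
    then show ?thesis using 3 by simp
  next
    case 2
    have "((\<lambda>h. \<bar>h\<bar> ^ Suc n) \<longlongrightarrow> 0) (at (0::real))"
      by (auto intro!: tendsto_eq_intros)
    then have "((\<lambda>h. (max (x + h - c) 0 ^ Suc (Suc n) - max (x - c) 0 ^ Suc (Suc n)) / h) \<longlongrightarrow> 0) (at 0)"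
    proof (rule tendsto_0_le[where K = 1])
      show "\<forall>\<^sub>F h in at 0. norm ((max (x + h - c) 0 ^ Suc (Suc n) - max (x - c) 0 ^ Suc (Suc n)) / h)
          \<le> norm (\<bar>h\<bar> ^ Suc n) * 1"
      proof (intro always_eventually allI)
        fix h :: real
        show "norm ((max (x + h - c) 0 ^ Suc (Suc n) - max (x - c) 0 ^ Suc (Suc n)) / h) \<le> norm (\<bar>h\<bar> ^ Suc n) * 1"
        proof (cases "h > 0")
          case False
          then have "max (x + h - c) 0 = 0" using 2 by simp
          then show ?thesis using 2 by (simp del: power_Suc add: zero_power)
        qed (use 2 in simp)
      qed
    qed
    then show ?thesis using 2 by (simp add: DERIV_def)
  qed
qed

definition lipschitz_primitive :: "real \<Rightarrow> real \<Rightarrow> (real \<Rightarrow> real) \<Rightarrow> (real \<Rightarrow> real) \<Rightarrow> bool" where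
  "lipschitz_primitive B L G g \<longleftrightarrow> 0 \<le> L \<and> G 0 = 0 \<and>
     (\<forall>x\<in>{0..B}. (G has_real_derivative g x) (at x)) \<and>
     (\<forall>x\<in>{0..B}. \<forall>y\<in>{0..B}. \<bar>g x - g y\<bar> \<le> L * \<bar>x - y\<bar>)"

lemma lipschitz_primitive_add:
  assumes "lipschitz_primitive B L G g" "lipschitz_primitive B L' G' g'"
  shows "lipschitz_primitive B (L + L') (\<lambda>x. G x + G' x) (\<lambda>x. g x + g' x)"
  unfolding lipschitz_primitive_def
proof (intro conjI ballI)
  fix x y assume xy: "x \<in> {0..B}" "y \<in> {0..B}"
  have "\<bar>g x - g y\<bar> \<le> L * \<bar>x - y\<bar>" "\<bar>g' x - g' y\<bar> \<le> L' * \<bar>x - y\<bar>"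
    using assms xy by (auto simp: lipschitz_primitive_def)
  then show "\<bar>(g x + g' x) - (g y + g' y)\<bar> \<le> (L + L') * \<bar>x - y\<bar>"
    by (simp add: algebra_simps)
qed (use assms in \<open>auto simp: lipschitz_primitive_def intro!: DERIV_add\<close>)

lemma lipschitz_primitive_cmult:
  assumes "lipschitz_primitive B L G g"
  shows "lipschitz_primitive B (\<bar>c\<bar> * L) (\<lambda>x. c * G x) (\<lambda>x. c * g x)"
  unfolding lipschitz_primitive_def
proof (intro conjI ballI)
  fix x y assume xy: "x \<in> {0..B}" "y \<in> {0..B}"
  have "\<bar>c * g x - c * g y\<bar> = \<bar>c\<bar> * \<bar>g x - g y\<bar>" by (simp add: right_diff_distrib[symmetric] abs_mult)
  also have "\<dots> \<le> \<bar>c\<bar> * (L * \<bar>x - y\<bar>)"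
    using assms xy by (intro mult_left_mono) (auto simp: lipschitz_primitive_def)
  finally show "\<bar>c * g x - c * g y\<bar> \<le> \<bar>c\<bar> * L * \<bar>x - y\<bar>" by (simp add: mult.assoc)
qed (use assms in \<open>auto simp: lipschitz_primitive_def intro!: DERIV_cmult\<close>)

lemma lipschitz_primitive_const: "lipschitz_primitive B 0 (\<lambda>x. c * x) (\<lambda>_. c)"
  by (auto simp: lipschitz_primitive_def intro!: derivative_eq_intros)

lemma lipschitz_primitive_square:
  assumes "0 \<le> B"
  shows "lipschitz_primitive B (2 * B) (\<lambda>x. x ^ 3 / 3) (\<lambda>x. x\<^sup>2)"
  unfolding lipschitz_primitive_def
proof (intro conjI ballI)
  fix x y assume xy: "x \<in> {0..B}" "y \<in> {0..B}"
  have "\<bar>x\<^sup>2 - y\<^sup>2\<bar> = \<bar>x + y\<bar> * \<bar>x - y\<bar>" by (simp add: abs_mult[symmetric] power2_eq_square algebra_simps)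
  also have "\<dots> \<le> 2 * B * \<bar>x - y\<bar>" using xy by (intro mult_right_mono) auto
  finally show "\<bar>x\<^sup>2 - y\<^sup>2\<bar> \<le> 2 * B * \<bar>x - y\<bar>" .
qed (use assms in \<open>auto intro!: derivative_eq_intros\<close>)

lemma lipschitz_primitive_trunc:
  assumes "0 \<le> c"
  shows "lipschitz_primitive B 1 (\<lambda>x. (max (x - c) 0)\<^sup>2 / 2) (\<lambda>x. max (x - c) 0)"
  unfolding lipschitz_primitive_def
proof (intro conjI ballI)
  fix x
  show "((\<lambda>x. (max (x - c) 0)\<^sup>2 / 2) has_real_derivative max (x - c) 0) (at x)"
    using DERIV_cdivide[OF has_real_derivative_trunc_power[of c 0 x], of 2] by (simp add: numeral_2_eq_2)
qed (use assms in auto)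

lemma lipschitz_primitive_trunc_square:
  assumes "0 \<le> c" "0 \<le> B"
  shows "lipschitz_primitive B (2 * B) (\<lambda>x. max (x - c) 0 ^ 3 / 3) (\<lambda>x. (max (x - c) 0)\<^sup>2)"
  unfolding lipschitz_primitive_def
proof (intro conjI ballI)
  fix x
  show "((\<lambda>x. max (x - c) 0 ^ 3 / 3) has_real_derivative (max (x - c) 0)\<^sup>2) (at x)"
    using DERIV_cdivide[OF has_real_derivative_trunc_power[of c 1 x], of 3] by (simp add: numeral_2_eq_2 numeral_3_eq_3)
next
  fix x y assume xy: "x \<in> {0..B}" "y \<in> {0..B}"
  let ?u = "max (x - c) 0" and ?v = "max (y - c) 0"
  have "\<bar>?u\<^sup>2 - ?v\<^sup>2\<bar> = \<bar>?u + ?v\<bar> * \<bar>?u - ?v\<bar>"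
    unfolding abs_mult[symmetric] by (simp add: power2_eq_square algebra_simps)
  also have "\<dots> \<le> 2 * B * \<bar>x - y\<bar>" using xy assms by (intro mult_mono) auto
  finally show "\<bar>?u\<^sup>2 - ?v\<^sup>2\<bar> \<le> 2 * B * \<bar>x - y\<bar>" .
qed (use assms in auto)

lemma sum_band_lipschitz_primitive:
  fixes m t :: nat and g G :: "real \<Rightarrow> real"
  assumes "m > 0" "lipschitz_primitive B L G g" "t / m \<le> B"
  shows "\<bar>(\<Sum>k\<in>band e t. g (\<bar>k\<bar> / m)) - m * G (t / m)\<bar> \<le> L * (t / m) + \<bar>g (t / m)\<bar>"
  using assms unfolding lipschitz_primitive_def by (intro sum_band_approx) auto

lemma lipschitz_primitive_mono:
  "lipschitz_primitive B L G g \<Longrightarrow> B' \<le> B \<Longrightarrow> lipschitz_primitive B' L G g"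
  by (auto simp: lipschitz_primitive_def)

section \<open>Occupied lines and unoccupied diagonals\<close>

text \<open>
  If every line of a family \<open>P\<close> carries a queen, a nonnegative weight of lines summed over \<open>P\<close> can only
  grow when it is summed over the queens.
\<close>

lemma sum_le_sum_preimage:
  fixes h :: "'b \<Rightarrow> real"
  assumes "finite C" "P \<subseteq> f ` C" "\<And>k. k \<in> P \<Longrightarrow> 0 \<le> h k"
  shows "sum h P \<le> (\<Sum>q\<in>C. if f q \<in> P then h (f q) else 0)"
proof -
  have "P = f ` {q \<in> C. f q \<in> P}" using assms(2) by auto
  then have "sum h P = sum h (f ` {q \<in> C. f q \<in> P})" by simp
  also have "\<dots> \<le> sum (h \<circ> f) {q \<in> C. f q \<in> P}"
    using assms by (intro sum_image_le) auto
  also have "\<dots> = (\<Sum>q\<in>C. if f q \<in> P then h (f q) else 0)"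
    using assms(1) by (simp add: sum.inter_filter)
  finally show ?thesis .
qed

text \<open>
  The counterpart for upper bounds: each diagonal of \<open>D\<close> pays its weight \<open>\<phi>\<close> once, and all queens
  beyond these, whether on a diagonal of \<open>D\<close> for the second time or outside \<open>D\<close>, pay at most \<open>\<Phi>\<close>.
  It is the previous lemma for the weight \<open>\<Phi> - \<phi>\<close>.
\<close>

lemma sum_capped_le:
  fixes \<phi> :: "'b \<Rightarrow> real"
  assumes "finite C" "D \<subseteq> f ` C" "\<And>k. k \<in> D \<Longrightarrow> \<phi> k \<le> \<Phi>"
  shows "(\<Sum>q\<in>C. if f q \<in> D then \<phi> (f q) else \<Phi>) \<le> sum \<phi> D + \<Phi> * (real (card C) - card D)"
proof -
  have "(\<Sum>k\<in>D. \<Phi> - \<phi> k) \<le> (\<Sum>q\<in>C. if f q \<in> D then \<Phi> - \<phi> (f q) else 0)"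
    using assms by (intro sum_le_sum_preimage) auto
  also have "\<dots> = (\<Sum>q\<in>C. \<Phi> - (if f q \<in> D then \<phi> (f q) else \<Phi>))"
    by (intro sum.cong) auto
  finally show ?thesis by (simp add: sum_subtractf algebra_simps)
qed

text \<open>
  The distance from \<open>0\<close> of the first gap of \<open>A\<close> among the integers of one parity, \<open>e\<close> meaning
  "even".
\<close>

definition reach :: "int set \<Rightarrow> bool \<Rightarrow> nat" where
  "reach A e = (LEAST u. even u = e \<and> \<not> {int u, - int u} \<subseteq> A)"

lemma below_reach:
  assumes "\<bar>k\<bar> < int (reach A e)" "even k = e"
  shows "k \<in> A"
proof -
  have "nat \<bar>k\<bar> < reach A e" using assms by linarith
  from not_less_Least[OF this[unfolded reach_def]]
  have "{int (nat \<bar>k\<bar>), - int (nat \<bar>k\<bar>)} \<subseteq> A" using assms by (auto simp: even_nat_iff)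
  then show ?thesis by (cases "k \<ge> 0") auto
qed

lemma reach_witness:
  assumes "finite A"
  obtains k where "\<bar>k\<bar> = int (reach A e)" "even k = e" "k \<notin> A"
proof -
  let ?Q = "\<lambda>u. even u = e \<and> \<not> {int u, - int u} \<subseteq> A"
  have "finite (int -` A)" using assms by (intro finite_vimageI) (auto simp: inj_def)
  then obtain N where N: "\<And>u. int u \<in> A \<Longrightarrow> u < N" by (auto simp: finite_nat_set_iff_bounded)
  define u where "u = 2 * N + (if e then 0 else 1)"
  have "even u = e" "int u \<notin> A" using N[of u] by (auto simp: u_def)
  then have "?Q u" by auto
  then have "?Q (reach A e)" unfolding reach_def by (rule LeastI)
  then show thesis using that[of "int (reach A e)"] that[of "- int (reach A e)"] by auto
qed

lemma reach_sum_le_card: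
  assumes "finite A"
  shows "reach A True + reach A False \<le> card A + 2"
proof -
  have "band True (reach A True) \<union> band False (reach A False) \<subseteq> A"
    by (auto simp: band_def intro: below_reach)
  then have "card (band True (reach A True) \<union> band False (reach A False)) \<le> card A"
    using assms by (rule card_mono[rotated])
  moreover have "band True (reach A True) \<inter> band False (reach A False) = {}"
    by (auto simp: band_def)
  ultimately show ?thesis
    using card_band_ge[of "reach A True" True] card_band_ge[of "reach A False" False]
    by (simp add: card_Un_disjoint)
qed

locale covered_board =
  fixes n m :: nat and p :: int and C :: "square set"
  assumes n_eq: "n = 2 * m + 1" and m_pos: "m > 0" and cover: "p_cover n p C"
begin

lemma indices_eq: "indices n = {X. \<bar>X\<bar> \<le> int m}"
  by (simp add: indices_def n_eq)

lemma C_on_board: "C \<subseteq> board n"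
  using cover by (simp add: p_cover_def orthodox_def)

lemma on_board: "(X, Y) \<in> C \<Longrightarrow> \<bar>X\<bar> \<le> int m \<and> \<bar>Y\<bar> \<le> int m"
  using C_on_board by (auto simp: board_def indices_eq)

lemma finite_C: "finite C"
proof (rule finite_subset[OF C_on_board])
  have "indices n = {- int m..int m}" by (auto simp: indices_eq)
  then show "finite (board n)" by (simp add: board_def)
qed

text \<open>
  Only diagonals with an even index are recorded, by half of their index; squares whose coordinates
  have equal parity lie on no others.
\<close>

definition occ_diffs :: "int set" where "occ_diffs = {a. occupies C (diff_diagonal n (2 * a))}"
definition occ_sums :: "int set" where "occ_sums = {b. occupies C (sum_diagonal n (2 * b))}"

lemma occ_diffs_subset: "(\<lambda>a. 2 * a) ` occ_diffs \<subseteq> (\<lambda>(X, Y). Y - X) ` C"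
  by (auto simp: occ_diffs_def occupies_def diff_diagonal_def image_iff) force

lemma occ_sums_subset: "(\<lambda>b. 2 * b) ` occ_sums \<subseteq> (\<lambda>(X, Y). X + Y) ` C"
  by (auto simp: occ_sums_def occupies_def sum_diagonal_def image_iff) force

lemma finite_diffs: "finite occ_diffs" and card_diffs: "card occ_diffs \<le> card C"
proof -
  have i: "inj_on (\<lambda>a. 2 * a :: int) occ_diffs" by (simp add: inj_on_def)
  show "finite occ_diffs"
    by (rule finite_imageD[OF finite_subset[OF occ_diffs_subset] i]) (simp add: finite_C)
  have "card occ_diffs = card ((\<lambda>a. 2 * a) ` occ_diffs)" by (simp add: card_image i)
  also have "\<dots> \<le> card ((\<lambda>(X, Y). Y - X) ` C)" using finite_C by (intro card_mono occ_diffs_subset) auto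
  also have "\<dots> \<le> card C" by (rule card_image_le[OF finite_C])
  finally show "card occ_diffs \<le> card C" .
qed

lemma finite_sums: "finite occ_sums" and card_sums: "card occ_sums \<le> card C"
proof -
  have i: "inj_on (\<lambda>a. 2 * a :: int) occ_sums" by (simp add: inj_on_def)
  show "finite occ_sums"
    by (rule finite_imageD[OF finite_subset[OF occ_sums_subset] i]) (simp add: finite_C)
  have "card occ_sums = card ((\<lambda>a. 2 * a) ` occ_sums)" by (simp add: card_image i)
  also have "\<dots> \<le> card ((\<lambda>(X, Y). X + Y) ` C)" using finite_C by (intro card_mono occ_sums_subset) auto
  also have "\<dots> \<le> card C" by (rule card_image_le[OF finite_C])
  finally show "card occ_sums \<le> card C" .
qed

text \<open>
  The diagonals meet in \<open>(b - a, a + b)\<close>. Both coordinates have parity \<open>1 - p\<close>, so on the board this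
  square would be uncovered.
\<close>

lemma missing_diagonals_far:
  assumes "a \<notin> occ_diffs" "b \<notin> occ_sums" "even (a + b) \<longleftrightarrow> odd p"
  shows "int m < \<bar>a\<bar> + \<bar>b\<bar>"
proof (rule ccontr)
  assume "\<not> ?thesis"
  then have "\<bar>b - a\<bar> \<le> int m" "\<bar>a + b\<bar> \<le> int m" by auto
  then have "(b - a, a + b) \<in> board n" by (simp add: board_def indices_eq)
  moreover have "[b - a = 1 - p] (mod 2)" "[a + b = 1 - p] (mod 2)"
    using assms(3) by (auto simp: cong_iff_dvd_diff)
  ultimately have "occupies C (diff_diagonal n (a + b - (b - a))) \<or> occupies C (sum_diagonal n (b - a + (a + b)))"
    using cover unfolding p_cover_def by blast
  moreover have "a + b - (b - a) = 2 * a" "b - a + (a + b) = 2 * b" by auto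
  ultimately show False using assms(1,2) by (simp add: occ_diffs_def occ_sums_def)
qed

lemma reach_diffs_sums:
  assumes "(e = e') \<longleftrightarrow> odd p"
  shows "m < reach occ_diffs e + reach occ_sums e'"
proof -
  obtain a where a: "\<bar>a\<bar> = int (reach occ_diffs e)" "even a = e" "a \<notin> occ_diffs"
    using reach_witness[OF finite_diffs] by blast
  obtain b where b: "\<bar>b\<bar> = int (reach occ_sums e')" "even b = e'" "b \<notin> occ_sums"
    using reach_witness[OF finite_sums] by blast
  have "int m < \<bar>a\<bar> + \<bar>b\<bar>"
    using a b assms by (intro missing_diagonals_far) auto
  then show ?thesis using a b by linarith
qed

text \<open>
  A queen whose coordinates have parity \<open>p\<close> has \<open>a \<equiv> b + p (mod 2)\<close>. So the class of a sum diagonal is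
  the parity of \<open>b + p\<close>, and the two families get a common radius for each class.
\<close>

definition radius :: "bool \<Rightarrow> nat" where
  "radius e = min (reach occ_diffs e) (reach occ_sums (e = even p))"

definition diff_core :: "int set" where "diff_core = {a. \<bar>a\<bar> < int (radius (even a))}"
definition sum_core :: "int set" where "sum_core = {b. \<bar>b\<bar> < int (radius (even (b + p)))}"

lemma diff_core_subset: "diff_core \<subseteq> occ_diffs"
  by (auto simp: diff_core_def radius_def intro!: below_reach[OF _ refl])

lemma sum_core_subset: "sum_core \<subseteq> occ_sums"
proof
  fix b assume "b \<in> sum_core"
  moreover have "(even (b + p) = even p) = even b" by auto
  ultimately have "\<bar>b\<bar> < int (reach occ_sums (even b))" by (auto simp: sum_core_def radius_def)
  then show "b \<in> occ_sums" by (rule below_reach) simp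
qed

lemma diff_core_bands: "diff_core = band True (radius True) \<union> band False (radius False)"
proof (rule set_eqI)
  show "a \<in> diff_core \<longleftrightarrow> a \<in> band True (radius True) \<union> band False (radius False)" for a
    by (cases "even a") (simp_all add: diff_core_def band_def)
qed

lemma sum_core_bands: "sum_core = band (even p) (radius True) \<union> band (odd p) (radius False)"
proof (rule set_eqI)
  show "b \<in> sum_core \<longleftrightarrow> b \<in> band (even p) (radius True) \<union> band (odd p) (radius False)" for b
    by (cases "even b"; cases "even p") (simp_all add: sum_core_def band_def)
qed

text \<open>
  Each of the four ways to choose the minima in the two radii gives a bound: gaps \<open>g\<close>, \<open>g'\<close> of
  matching classes in different families satisfy \<open>g + g' > m\<close>. The four gaps of both families thus
  add up to at least \<open>2 m + 2\<close>, and the two in one family to at most \<open>|C| + 2\<close>, which bounds the two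
  in the other family from below.
\<close>

lemma radius_sum_ge: "2 * m \<le> radius True + radius False + card C"
  using reach_diffs_sums[of True "odd p"] reach_diffs_sums[of False "even p"]
    reach_sum_le_card[OF finite_diffs] reach_sum_le_card[OF finite_sums] card_diffs card_sums
  by (cases "even p") (auto simp: radius_def min_def)

lemma radius_sum_le: "radius True + radius False \<le> card C + 2"
  using reach_sum_le_card[OF finite_diffs] card_diffs by (auto simp: radius_def min_def)

definition ratio :: "bool \<Rightarrow> real" where "ratio e = radius e / m"

end

section \<open>Testing a cover against weights\<close>

text \<open>
  The inequalities which the weights must satisfy for a queen at \<open>u = |a|/m\<close>, \<open>v = |b|/m\<close>: both
  diagonals of the same class; one of them outside the core, where it pays \<open>\<Phi>\<close>; diagonals of different
  classes, in which case neither the row nor the column has parity \<open>p\<close> and counts; both diagonals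
  outside the core.
\<close>

definition admissible :: "(real \<Rightarrow> real) \<Rightarrow> (bool \<Rightarrow> real \<Rightarrow> real) \<Rightarrow> real \<Rightarrow> bool" where
  "admissible h \<phi> \<Phi> \<longleftrightarrow> (\<forall>x. 0 \<le> x \<and> x \<le> 1 \<longrightarrow> 0 \<le> h x) \<and>
     (\<forall>u v. 0 \<le> u \<and> 0 \<le> v \<and> u + v \<le> 1 \<longrightarrow>
        (\<forall>e. h (u + v) + h \<bar>u - v\<bar> \<le> \<phi> e u + \<phi> e v \<and> h (u + v) + h \<bar>u - v\<bar> \<le> \<phi> e u + \<Phi>) \<and>
        0 \<le> \<phi> True u + \<phi> False v \<and> h (u + v) + h \<bar>u - v\<bar> \<le> 2 * \<Phi>)"

context covered_board
begin

text \<open>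
  Weak duality. The queen at \<open>(x, y)\<close> has \<open>{|x|, |y|} = m {u + v, |u - v|}\<close>, so the weights of its row
  and column are bounded by those of its two diagonals; the rest is double counting.
\<close>

lemma weighted_count:
  fixes h :: "real \<Rightarrow> real" and \<phi> :: "bool \<Rightarrow> real \<Rightarrow> real" and \<Phi> :: real
  assumes h_nonneg: "\<And>x. 0 \<le> x \<Longrightarrow> x \<le> 1 \<Longrightarrow> 0 \<le> h x"
    and cap: "\<And>e x. 0 \<le> x \<Longrightarrow> x \<le> ratio e \<Longrightarrow> \<phi> e x \<le> \<Phi>"
    and same: "\<And>e u v. 0 \<le> u \<Longrightarrow> 0 \<le> v \<Longrightarrow> u + v \<le> 1 \<Longrightarrow> h (u + v) + h \<bar>u - v\<bar> \<le> \<phi> e u + \<phi> e v"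
    and mixed: "\<And>u v. 0 \<le> u \<Longrightarrow> 0 \<le> v \<Longrightarrow> u + v \<le> 1 \<Longrightarrow> 0 \<le> \<phi> True u + \<phi> False v"
    and half: "\<And>e u v. 0 \<le> u \<Longrightarrow> 0 \<le> v \<Longrightarrow> u + v \<le> 1 \<Longrightarrow> h (u + v) + h \<bar>u - v\<bar> \<le> \<phi> e u + \<Phi>"
    and none: "\<And>u v. 0 \<le> u \<Longrightarrow> 0 \<le> v \<Longrightarrow> u + v \<le> 1 \<Longrightarrow> h (u + v) + h \<bar>u - v\<bar> \<le> 2 * \<Phi>"
  shows "2 * (\<Sum>k\<in>band (even p) m. h (\<bar>k\<bar> / m)) \<le>
    (\<Sum>a\<in>diff_core. \<phi> (even a) (\<bar>a\<bar> / m)) + (\<Sum>b\<in>sum_core. \<phi> (even (b + p)) (\<bar>b\<bar> / m))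
    + \<Phi> * (2 * real (card C) - card diff_core - card sum_core)"
proof -
  define P where "P = band (even p) m"
  define D where "D = (\<lambda>a::int. 2 * a) ` diff_core"
  define S where "S = (\<lambda>b::int. 2 * b) ` sum_core"
  define wt where "wt k = (if k \<in> P then h (\<bar>k\<bar> / m) else 0)" for k :: int
  define fd where "fd d = \<phi> (even (d div 2)) (\<bar>d div 2\<bar> / m)" for d :: int
  define fs where "fs s = \<phi> (even (s div 2 + p)) (\<bar>s div 2\<bar> / m)" for s :: int
  have P_idx: "\<bar>k\<bar> \<le> int m" "[k = p] (mod 2)" if "k \<in> P" for k
    using that by (auto simp: P_def band_def cong_iff_dvd_diff)
  have P_nonneg: "0 \<le> h (\<bar>k\<bar> / m)" if "k \<in> P" for k
    using P_idx(1)[OF that] m_pos by (intro h_nonneg) (auto simp: divide_simps)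
  have occ: "occupies C (column n k) \<and> occupies C (row n k)" if "k \<in> P" for k
    using P_idx[OF that] cover by (auto simp: p_cover_def orthodox_def indices_eq)
  have "P \<subseteq> fst ` C" "P \<subseteq> snd ` C"
    using occ by (force simp: occupies_def column_def row_def image_iff)+
  then have cols: "(\<Sum>k\<in>P. h (\<bar>k\<bar> / m)) \<le> (\<Sum>q\<in>C. wt (fst q))"
    and rows: "(\<Sum>k\<in>P. h (\<bar>k\<bar> / m)) \<le> (\<Sum>q\<in>C. wt (snd q))"
    unfolding wt_def
    using sum_le_sum_preimage[OF finite_C, of P fst "\<lambda>k. h (\<bar>k\<bar> / m)"]
      sum_le_sum_preimage[OF finite_C, of P snd "\<lambda>k. h (\<bar>k\<bar> / m)"] P_nonneg by auto
  have D_sub: "D \<subseteq> (\<lambda>(X, Y). Y - X) ` C" and S_sub: "S \<subseteq> (\<lambda>(X, Y). X + Y) ` C"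
    using occ_diffs_subset occ_sums_subset diff_core_subset sum_core_subset unfolding D_def S_def by blast+
  have frac: "\<bar>real_of_int k\<bar> / m \<le> ratio e" if "\<bar>k\<bar> < int (radius e)" for k e
    using that unfolding ratio_def by (intro divide_right_mono) linarith+
  have D_cap: "fd d \<le> \<Phi>" if "d \<in> D" for d
    using that unfolding D_def fd_def diff_core_def by (auto intro!: cap frac)
  have S_cap: "fs s \<le> \<Phi>" if "s \<in> S" for s
    using that unfolding S_def fs_def sum_core_def by (auto intro!: cap frac)
  define vd where "vd d = (if d \<in> D then fd d else \<Phi>)" for d
  define vs where "vs s = (if s \<in> S then fs s else \<Phi>)" for s
  have "(\<Sum>q\<in>C. vd ((\<lambda>(X, Y). Y - X) q)) \<le> sum fd D + \<Phi> * (real (card C) - card D)"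
    unfolding vd_def by (rule sum_capped_le[OF finite_C D_sub D_cap])
  moreover have "sum fd D = (\<Sum>a\<in>diff_core. \<phi> (even a) (\<bar>a\<bar> / m))" "card D = card diff_core"
    unfolding D_def by (simp_all add: sum.reindex card_image inj_on_def fd_def)
  ultimately have diag_d: "(\<Sum>q\<in>C. vd (snd q - fst q)) \<le>
      (\<Sum>a\<in>diff_core. \<phi> (even a) (\<bar>a\<bar> / m)) + \<Phi> * (real (card C) - card diff_core)"
    by (simp add: case_prod_beta)
  have "(\<Sum>q\<in>C. vs ((\<lambda>(X, Y). X + Y) q)) \<le> sum fs S + \<Phi> * (real (card C) - card S)"
    unfolding vs_def by (rule sum_capped_le[OF finite_C S_sub S_cap])
  moreover have "sum fs S = (\<Sum>b\<in>sum_core. \<phi> (even (b + p)) (\<bar>b\<bar> / m))" "card S = card sum_core"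
    unfolding S_def by (simp_all add: sum.reindex card_image inj_on_def fs_def)
  ultimately have diag_s: "(\<Sum>q\<in>C. vs (fst q + snd q)) \<le>
      (\<Sum>b\<in>sum_core. \<phi> (even (b + p)) (\<bar>b\<bar> / m)) + \<Phi> * (real (card C) - card sum_core)"
    by (simp add: case_prod_beta)
  have pointwise: "wt x + wt y \<le> vd (y - x) + vs (x + y)" if q: "(x, y) \<in> C" for x y
  proof -
    define u v where "u = \<bar>real_of_int (y - x)\<bar> / (2 * m)" and "v = \<bar>real_of_int (x + y)\<bar> / (2 * m)"
    have xy: "\<bar>x\<bar> \<le> int m" "\<bar>y\<bar> \<le> int m" using on_board[OF q] by auto
    have uv: "0 \<le> u" "0 \<le> v" by (auto simp: u_def v_def)
    have "\<bar>y - x\<bar> + \<bar>x + y\<bar> \<le> 2 * int m" using xy by linarith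
    then have "\<bar>real_of_int (y - x)\<bar> + \<bar>real_of_int (x + y)\<bar> \<le> 2 * real m" by linarith
    then have uv1: "u + v \<le> 1" using m_pos by (simp add: u_def v_def add_divide_distrib[symmetric])
    have H: "h (u + v) + h \<bar>u - v\<bar> = h (\<bar>x\<bar> / m) + h (\<bar>y\<bar> / m)"
    proof -
      have "u + v = (\<bar>real_of_int (y - x)\<bar> + \<bar>real_of_int (x + y)\<bar>) / (2 * m)"
        by (simp add: u_def v_def add_divide_distrib)
      moreover have "\<bar>u - v\<bar> = \<bar>\<bar>real_of_int (y - x)\<bar> - \<bar>real_of_int (x + y)\<bar>\<bar> / (2 * m)"
        by (simp add: u_def v_def diff_divide_distrib[symmetric] abs_divide)
      moreover have "(\<bar>real_of_int (y - x)\<bar> + \<bar>real_of_int (x + y)\<bar> = 2 * \<bar>x\<bar> \<and>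
          \<bar>\<bar>real_of_int (y - x)\<bar> - \<bar>real_of_int (x + y)\<bar>\<bar> = 2 * \<bar>y\<bar>) \<or>
        (\<bar>real_of_int (y - x)\<bar> + \<bar>real_of_int (x + y)\<bar> = 2 * \<bar>y\<bar> \<and>
          \<bar>\<bar>real_of_int (y - x)\<bar> - \<bar>real_of_int (x + y)\<bar>\<bar> = 2 * \<bar>x\<bar>)"
        by (simp add: abs_if)
      ultimately show ?thesis by auto
    qed
    have wt_le: "wt k \<le> h (\<bar>k\<bar> / m)" if "\<bar>k\<bar> \<le> int m" for k
      using that m_pos h_nonneg[of "\<bar>k\<bar> / m"] by (auto simp: wt_def divide_simps)
    have le_H: "wt x + wt y \<le> h (u + v) + h \<bar>u - v\<bar>" using wt_le[of x] wt_le[of y] xy unfolding H by simp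
    show ?thesis
    proof (cases "y - x \<in> D")
      case D: True
      then obtain a where a: "y - x = 2 * a" "a \<in> diff_core" by (auto simp: D_def)
      then have va: "vd (y - x) = \<phi> (even a) u" using D by (simp add: vd_def fd_def u_def abs_mult)
      show ?thesis
      proof (cases "x + y \<in> S")
        case S: True
        then obtain b where b: "x + y = 2 * b" "b \<in> sum_core" by (auto simp: S_def)
        then have vb: "vs (x + y) = \<phi> (even (b + p)) v" using S by (simp add: vs_def fs_def v_def abs_mult)
        have ab: "x = b - a" "y = a + b" using a b by auto
        show ?thesis
        proof (cases "even (b + p) = even a")
          case True
          then show ?thesis using same[OF uv uv1, of "even a"] le_H va vb by simp
        next
          case False
          \<comment> \<open>Neither the row nor the column has parity \<open>p\<close>.\<close>
          then have "x \<notin> P" "y \<notin> P" unfolding ab by (auto simp: P_def band_def)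
          then have "wt x + wt y = 0" by (simp add: wt_def)
          moreover have "0 \<le> \<phi> (even a) u + \<phi> (even (b + p)) v"
            using False mixed[OF uv uv1] mixed[OF uv(2,1)] uv1 by (cases "even a") (auto simp: add.commute)
          ultimately show ?thesis using va vb by simp
        qed
      next
        case False
        then show ?thesis using half[OF uv uv1, of "even a"] le_H va by (simp add: vs_def)
      qed
    next
      case D: False
      show ?thesis
      proof (cases "x + y \<in> S")
        case S: True
        then obtain b where b: "x + y = 2 * b" "b \<in> sum_core" by (auto simp: S_def)
        then have "vs (x + y) = \<phi> (even (b + p)) v" using S by (simp add: vs_def fs_def v_def abs_mult)
        moreover have "h (u + v) + h \<bar>u - v\<bar> \<le> \<phi> (even (b + p)) v + \<Phi>"
          using half[OF uv(2,1), of "even (b + p)"] uv1 by (simp add: add.commute abs_minus_commute)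
        ultimately show ?thesis using D le_H by (simp add: vd_def)
      next
        case False
        then show ?thesis using D none[OF uv uv1] le_H by (simp add: vd_def vs_def)
      qed
    qed
  qed
  have "2 * (\<Sum>k\<in>P. h (\<bar>k\<bar> / m)) \<le> (\<Sum>q\<in>C. wt (fst q) + wt (snd q))"
    using cols rows by (simp add: sum.distrib)
  also have "\<dots> \<le> (\<Sum>q\<in>C. vd (snd q - fst q) + vs (fst q + snd q))"
    using pointwise by (intro sum_mono) auto
  also have "\<dots> \<le> (\<Sum>a\<in>diff_core. \<phi> (even a) (\<bar>a\<bar> / m)) + \<Phi> * (real (card C) - card diff_core) +
     ((\<Sum>b\<in>sum_core. \<phi> (even (b + p)) (\<bar>b\<bar> / m)) + \<Phi> * (real (card C) - card sum_core))"
    using diag_d diag_s by (simp add: sum.distrib)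
  finally show ?thesis by (simp add: P_def algebra_simps)
qed

text \<open>
  The sums in \<open>weighted_count\<close> are replaced by integrals. The last term collects the
  discretisation errors, and a core of radii \<open>r\<close> and \<open>r'\<close> has at least \<open>r + r' - 2\<close> diagonals.
\<close>

lemma integrated_count:
  fixes h H :: "real \<Rightarrow> real" and \<phi> F :: "bool \<Rightarrow> real \<Rightarrow> real" and \<Phi> L :: real and L' :: "bool \<Rightarrow> real"
  assumes adm: "admissible h \<phi> \<Phi>"
    and cap: "\<And>e x. 0 \<le> x \<Longrightarrow> x \<le> ratio e \<Longrightarrow> \<phi> e x \<le> \<Phi>"
    and H: "lipschitz_primitive 1 L H h"
    and F: "\<And>e. lipschitz_primitive (ratio e) (L' e) (F e) (\<phi> e)"
    and Phi: "0 \<le> \<Phi>"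
  shows "2 * H 1 \<le> 2 * F True (ratio True) + 2 * F False (ratio False)
      + 2 * \<Phi> * (card C / m - ratio True - ratio False)
      + (2 * (L + \<bar>h 1\<bar>) + 2 * (\<Sum>e\<in>UNIV. L' e * ratio e + \<bar>\<phi> e (ratio e)\<bar>) + 4 * \<Phi>) / m"
proof -
  define E where "E e = L' e * ratio e + \<bar>\<phi> e (ratio e)\<bar>" for e
  \<comment> \<open>Summing up to \<open>m - 1\<close> drops at most the two outermost rows or columns, and \<open>H\<close> is only integrated up to \<open>1\<close>.\<close>
  have rows: "m * H 1 - (L + \<bar>h 1\<bar>) \<le> (\<Sum>k\<in>band (even p) m. h (\<bar>k\<bar> / m))"
    using sum_band_lipschitz_primitive[OF m_pos H, of m "even p"] m_pos by (simp add: abs_le_iff)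
  have bands: "(\<Sum>k\<in>band e' (radius e). \<phi> e (\<bar>k\<bar> / m)) \<le> m * F e (ratio e) + E e" for e e'
    using sum_band_lipschitz_primitive[OF m_pos F, of "radius e" e e'] by (simp add: abs_le_iff ratio_def E_def)
  have disj: "band e s \<inter> band (\<not> e) t = {}" for e s t by (auto simp: band_def)
  have split: "sum f (band e s \<union> band (\<not> e) t) = sum f (band e s) + sum f (band (\<not> e) t)"
    for f :: "int \<Rightarrow> real" and e s t
    by (intro sum.union_disjoint disj finite_band)
  have D: "(\<Sum>a\<in>diff_core. \<phi> (even a) (\<bar>a\<bar> / m)) =
      (\<Sum>k\<in>band True (radius True). \<phi> True (\<bar>k\<bar> / m)) + (\<Sum>k\<in>band False (radius False). \<phi> False (\<bar>k\<bar> / m))"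
    unfolding diff_core_bands split[of _ True, simplified]
    by (intro arg_cong2[of _ _ _ _ "(+)"] sum.cong) (auto simp: band_def)
  have S: "(\<Sum>b\<in>sum_core. \<phi> (even (b + p)) (\<bar>b\<bar> / m)) =
      (\<Sum>k\<in>band (even p) (radius True). \<phi> True (\<bar>k\<bar> / m)) + (\<Sum>k\<in>band (odd p) (radius False). \<phi> False (\<bar>k\<bar> / m))"
    unfolding sum_core_bands split
    by (intro arg_cong2[of _ _ _ _ "(+)"] sum.cong) (auto simp: band_def)
  have "card diff_core = card (band True (radius True)) + card (band False (radius False))"
    "card sum_core = card (band (even p) (radius True)) + card (band (odd p) (radius False))"
    unfolding diff_core_bands sum_core_bands using disj[of True] disj[of "even p"]
    by (simp_all add: card_Un_disjoint)
  then have "radius True + radius False \<le> card diff_core + 2" "radius True + radius False \<le> card sum_core + 2"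
    using card_band_ge[of "radius True" True] card_band_ge[of "radius False" False]
      card_band_ge[of "radius True" "even p"] card_band_ge[of "radius False" "odd p"] by linarith+
  then have c: "2 * real (card C) - card diff_core - card sum_core
      \<le> 2 * real (card C) - 2 * real (radius True) - 2 * real (radius False) + 4" by linarith
  have count: "2 * (\<Sum>k\<in>band (even p) m. h (\<bar>k\<bar> / m)) \<le>
    (\<Sum>a\<in>diff_core. \<phi> (even a) (\<bar>a\<bar> / m)) + (\<Sum>b\<in>sum_core. \<phi> (even (b + p)) (\<bar>b\<bar> / m))
    + \<Phi> * (2 * real (card C) - card diff_core - card sum_core)"
    using adm cap unfolding admissible_def by (intro weighted_count) auto
  have "\<Phi> * (2 * real (card C) - card diff_core - card sum_core)
      \<le> \<Phi> * (2 * real (card C) - 2 * real (radius True) - 2 * real (radius False) + 4)"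
    using c Phi by (intro mult_left_mono) auto
  then have "2 * (m * H 1 - (L + \<bar>h 1\<bar>)) \<le> 2 * (m * F True (ratio True) + E True)
      + 2 * (m * F False (ratio False) + E False) + \<Phi> * (2 * real (card C) - 2 * real (radius True) - 2 * real (radius False) + 4)"
    using count[unfolded D S] rows bands[of True True] bands[of False False]
      bands[of True "even p"] bands[of False "odd p"] by argo
  moreover have "real (radius e) = m * ratio e" for e using m_pos by (simp add: ratio_def)
  ultimately have "2 * m * H 1 \<le> 2 * m * F True (ratio True) + 2 * m * F False (ratio False)
      + 2 * \<Phi> * (card C - m * ratio True - m * ratio False) + (2 * (L + \<bar>h 1\<bar>) + 2 * (E True + E False) + 4 * \<Phi>)"
    by (simp add: algebra_simps)
  then have "(2 * m * H 1) / m \<le> (2 * m * F True (ratio True) + 2 * m * F False (ratio False)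
      + 2 * \<Phi> * (card C - m * ratio True - m * ratio False) + (2 * (L + \<bar>h 1\<bar>) + 2 * (E True + E False) + 4 * \<Phi>)) / m"
    using m_pos by (intro divide_right_mono) auto
  then show ?thesis using m_pos by (simp add: add_divide_distrib diff_divide_distrib right_diff_distrib UNIV_bool E_def)
qed

end

section \<open>Three systems of weights\<close>

text \<open>
  This rounds the corner of the hinge function in \<open>wide_bent\<close>. It equals \<open>5 (3/50 - x) (7/50 - x)\<close> on
  \<open>[0, 3/50]\<close>, which makes \<open>2 dent (x / 2)\<close> exactly the excess \<open>5/2 x^2 - (x - 21/250)\<close> of the parabola
  over the line for \<open>x \<le> 3/25\<close>.
\<close>

definition dent :: "real \<Rightarrow> real" where
  "dent x = 5 * (max (3/50 - x) 0)^2 + 2/5 * max (3/50 - x) 0"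

lemma dent_nonneg: "0 \<le> dent x"
  by (simp add: dent_def)

lemma dent_midpoint: "2 * dent ((x + y) / 2) \<le> dent x + dent y"
proof -
  define v w z where "v = max (3/50 - x) 0" and "w = max (3/50 - y) 0" and "z = max (3/50 - (x+y)/2) 0"
  have z: "0 \<le> z" "2 * z \<le> v + w" by (auto simp: v_def w_def z_def max_def field_simps)
  then have "(2 * z)^2 \<le> (v + w)^2" by (intro power_mono) auto
  moreover have "0 \<le> (v - w)^2" by simp
  ultimately have "2 * z^2 \<le> v^2 + w^2" unfolding power2_eq_square by (simp add: algebra_simps)
  then have "2 * (5 * z^2 + 2/5 * z) \<le> 5*v^2 + 2/5*v + (5*w^2 + 2/5*w)"
    using z by simp
  then show ?thesis by (simp add: dent_def v_def w_def z_def)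
qed

lemma dent_lipschitz:
  assumes "0 \<le> x" "0 \<le> y"
  shows "\<bar>dent x - dent y\<bar> \<le> \<bar>x - y\<bar>"
proof -
  define v w where "v = max (3/50 - x) 0" and "w = max (3/50 - y) 0"
  have b: "0 \<le> v" "v \<le> 3/50" "0 \<le> w" "w \<le> 3/50" and vw: "\<bar>v - w\<bar> \<le> \<bar>x - y\<bar>"
    using assms by (auto simp: v_def w_def max_def)
  have "dent x - dent y = (v - w) * (5 * (v + w) + 2/5)"
    unfolding dent_def v_def[symmetric] w_def[symmetric] by (simp add: field_simps power2_eq_square)
  then have "\<bar>dent x - dent y\<bar> = \<bar>v - w\<bar> * (5 * (v + w) + 2/5)"
    using b by (simp add: abs_mult)
  also have "\<dots> \<le> \<bar>v - w\<bar> * 1" using b by (intro mult_left_mono) auto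
  finally show ?thesis using vw by simp
qed

text \<open>
  The parabola and the line cross at \<open>3/25\<close> and at \<open>7/25\<close>. The function changes from one to the other
  at the upper crossing, so that it stays below the parabola everywhere and exceeds the line only on
  \<open>[0, 3/25)\<close>. The coefficients are rational numbers close to those for which the margin in \<open>no_small_cover\<close> is
  largest.
\<close>

definition bent :: "real \<Rightarrow> real" where
  "bent x = (if x \<le> 7/25 then 5/2 * x^2 else x - 21/250)"

lemma bent_le_square: "bent x \<le> 5/2 * x^2"
proof (cases "x \<le> 7/25")
  case False
  then have "0 \<le> 5/2 * ((x - 7/25) * (x - 3/25))" by simp
  then show ?thesis using False by (simp add: bent_def algebra_simps power2_eq_square)
qed (simp add: bent_def)

lemma bent_le_line: "0 \<le> x \<Longrightarrow> bent x \<le> x - 21/250 + 2 * dent (x / 2)"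
proof (cases "x \<le> 3/25")
  case True
  then have "max (3/50 - x/2) 0 = 3/50 - x/2" by simp
  then have "2 * dent (x/2) = 5/2 * x^2 - x + 21/250"
    by (simp add: dent_def power2_eq_square algebra_simps)
  then show ?thesis using True by (simp add: bent_def)
next
  case F: False
  show ?thesis
  proof (cases "x \<le> 7/25")
    case True
    then have "5/2 * ((x - 7/25) * (x - 3/25)) \<le> 0" using F by (intro mult_nonneg_nonpos mult_nonpos_nonneg) auto
    then have "5/2 * x^2 \<le> x - 21/250" by (simp add: algebra_simps power2_eq_square)
    then show ?thesis using True dent_nonneg[of "x/2"] by (simp add: bent_def)
  next
    case False
    then show ?thesis using dent_nonneg[of "x/2"] by (simp add: bent_def)
  qed
qed

text \<open>
  The corner \<open>79/200\<close> is about half of the larger critical ratio \<open>(3 + sqrt 3)/6 = 0.7886...\<close>, and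
  \<open>311/1000 = 79/200 - 21/250\<close> is the value of the line there.
\<close>

definition wide_bent :: "real \<Rightarrow> real" where
  "wide_bent u = 311/1000 + 2 * max (u - 79/200) 0 + dent \<bar>u - 79/200\<bar>"

text \<open>
  If \<open>A\<close> and \<open>B\<close> lie on different sides of \<open>0\<close> the hinges alone give equality and the claim is midpoint
  convexity of \<open>dent\<close>. On the same side the hinges leave twice the smaller absolute value to spare,
  which pays for replacing \<open>dent ((|A| + |B|)/2)\<close> by \<open>dent (||A| - |B||/2)\<close> because \<open>dent\<close> is
  1-Lipschitz.
\<close>

lemma dent_kink:
  assumes "B \<le> A"
  shows "2 * A + 2 * dent ((A - B) / 2) \<le> 2 * max A 0 + 2 * max B 0 + dent \<bar>A\<bar> + dent \<bar>B\<bar>"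
proof -
  consider "0 \<le> B" | "B \<le> 0" "0 \<le> A" | "A \<le> 0" by linarith
  then show ?thesis
  proof cases
    case 1
    have "\<bar>dent ((A - B)/2) - dent ((A + B)/2)\<bar> \<le> \<bar>(A - B)/2 - (A + B)/2\<bar>"
      using 1 assms by (intro dent_lipschitz) auto
    moreover have "\<bar>(A - B)/2 - (A + B)/2\<bar> = B" using 1 by (simp add: field_simps)
    ultimately show ?thesis using dent_midpoint[of A B] 1 assms by simp
  next
    case 2
    then show ?thesis using dent_midpoint[of A "-B"] by simp
  next
    case 3
    have "\<bar>dent ((A - B)/2) - dent ((- A - B)/2)\<bar> \<le> \<bar>(A - B)/2 - (- A - B)/2\<bar>"
      using 3 assms by (intro dent_lipschitz) auto
    moreover have "\<bar>(A - B)/2 - (- A - B)/2\<bar> = - A" using 3 by (simp add: field_simps)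
    ultimately show ?thesis using dent_midpoint[of "-A" "-B"] 3 assms by simp
  qed
qed

lemma bent_small: "\<bar>x\<bar> \<le> 3/25 \<Longrightarrow> bent x \<le> 1/10"
proof -
  assume a: "\<bar>x\<bar> \<le> 3/25"
  then have "x^2 \<le> (3/25)^2" using abs_le_square_iff[of x "3/25"] by simp
  then show ?thesis using a by (simp add: bent_def power2_eq_square)
qed

text \<open>
  Unless \<open>u\<close> and \<open>v\<close> are both tiny, \<open>bent (u + v)\<close> is bounded by the line and \<open>bent (u - v)\<close> by the line
  plus its excess; the two lines add up to \<open>2 u - 21/125\<close>, which no longer depends on \<open>v\<close>.
\<close>

lemma bent_le_wide_bent_ordered:
  assumes "0 \<le> v" "v \<le> u"
  shows "bent (u + v) + bent (u - v) \<le> wide_bent u + wide_bent v"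
proof (cases "u + v \<le> 3/25")
  case True
  then have "bent (u + v) + bent (u - v) \<le> 1/5"
    using bent_small[of "u + v"] bent_small[of "u - v"] assms by simp
  moreover have "311/1000 \<le> wide_bent u" "311/1000 \<le> wide_bent v"
    by (simp_all add: wide_bent_def dent_nonneg)
  ultimately show ?thesis by linarith
next
  case False
  then have "dent ((u + v) / 2) = 0" by (simp add: dent_def max_def)
  then have "bent (u + v) + bent (u - v) \<le> 2 * u - 21/125 + 2 * dent ((u - v) / 2)"
    using bent_le_line[of "u + v"] bent_le_line[of "u - v"] assms by simp
  also have "\<dots> \<le> wide_bent u + wide_bent v"
    using dent_kink[of "v - 79/200" "u - 79/200"] assms by (simp add: wide_bent_def)
  finally show ?thesis .
qed

lemma bent_le_wide_bent:
  assumes "0 \<le> u" "0 \<le> v"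
  shows "bent (u + v) + bent \<bar>u - v\<bar> \<le> wide_bent u + wide_bent v"
  using bent_le_wide_bent_ordered[of u v] bent_le_wide_bent_ordered[of v u] assms
  by (cases "u \<le> v") (auto simp: add.commute)

text \<open>
  The parallelogram identity, as \<open>bent\<close> is below the parabola.
\<close>

lemma bent_le_narrow: "bent (u + v) + bent \<bar>u - v\<bar> \<le> 5 * u^2 + 5 * v^2"
  using bent_le_square[of "u + v"] bent_le_square[of "\<bar>u - v\<bar>"]
  by (simp add: power2_eq_square algebra_simps)

text \<open>
  Subtracting \<open>3/4 x^2\<close> from the line weight and \<open>3/2 u^2\<close> from the diagonal weights changes no
  inequality, by the parallelogram identity. It brings all values that occur into \<open>[0, 1/2]\<close>, so that
  an exceptional queen costs only \<open>\<Phi> = 1/2\<close> for each of its diagonals, and it makes the integrated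
  inequality nearly stationary at the critical ratio.
\<close>

definition line_weight :: "real \<Rightarrow> real" where
  "line_weight x = bent x - 3/4 * x\<^sup>2"

definition narrow_weight :: "real \<Rightarrow> real" where
  "narrow_weight u = 7/2 * u\<^sup>2"

definition wide_weight :: "real \<Rightarrow> real" where
  "wide_weight u = wide_bent u - 3/2 * u\<^sup>2"

definition line_primitive :: "real \<Rightarrow> real" where
  "line_primitive x = 7/4 * (x ^ 3 / 3) + (- 5/2 * (max (x - 7/25) 0 ^ 3 / 3) + - 2/5 * ((max (x - 7/25) 0)\<^sup>2 / 2))"

definition wide_primitive :: "real \<Rightarrow> real" where
  "wide_primitive u = 311/1000 * u
     + (2/5 * ((max (u - 67/200) 0)\<^sup>2 / 2) + (2/5 * ((max (u - 91/200) 0)\<^sup>2 / 2)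
     + (5 * (max (u - 67/200) 0 ^ 3 / 3) + (- 5 * (max (u - 91/200) 0 ^ 3 / 3) + - 3/2 * (u ^ 3 / 3)))))"

lemma line_eq: "line_weight x = 7/4 * x\<^sup>2 + (- 5/2 * (max (x - 7/25) 0)\<^sup>2 + - 2/5 * max (x - 7/25) 0)"
  by (simp add: line_weight_def bent_def max_def power2_eq_square field_simps)

text \<open>
  The corner of the hinge at \<open>79/200\<close> cancels against the one of \<open>dent \<bar>u - 79/200\<bar>\<close>; what remains has
  kinks only at \<open>79/200 - 3/50\<close> and \<open>79/200 + 3/50\<close>.
\<close>

lemma wide_eq: "wide_weight u = 311/1000
     + (2/5 * max (u - 67/200) 0 + (2/5 * max (u - 91/200) 0
     + (5 * (max (u - 67/200) 0)\<^sup>2 + (- 5 * (max (u - 91/200) 0)\<^sup>2 + - 3/2 * u\<^sup>2))))"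
proof -
  consider "u \<le> 67/200" | "67/200 \<le> u" "u < 79/200" | "79/200 \<le> u" "u \<le> 91/200" | "91/200 \<le> u"
    by linarith
  then show ?thesis
    by cases (simp_all add: wide_weight_def wide_bent_def dent_def max_absorb1 max_absorb2 abs_if power2_eq_square field_simps)
qed

lemma line_primitive: "lipschitz_primitive 1 (89/10) line_primitive line_weight"
proof -
  have "lipschitz_primitive 1 (\<bar>7/4\<bar> * (2 * 1) + (\<bar>- 5/2\<bar> * (2 * 1) + \<bar>- 2/5\<bar> * 1)) line_primitive line_weight"
    unfolding line_primitive_def[abs_def] line_eq[abs_def]
    by (intro lipschitz_primitive_add lipschitz_primitive_cmult lipschitz_primitive_square
        lipschitz_primitive_trunc lipschitz_primitive_trunc_square) auto
  then show ?thesis by simp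
qed

lemma wide_primitive: "lipschitz_primitive 1 (119/5) wide_primitive wide_weight"
proof -
  have "lipschitz_primitive 1 (0 + (\<bar>2/5\<bar> * 1 + (\<bar>2/5\<bar> * 1 + (\<bar>5\<bar> * (2 * 1) + (\<bar>- 5\<bar> * (2 * 1) + \<bar>- 3/2\<bar> * (2 * 1))))))
      wide_primitive wide_weight"
    unfolding wide_primitive_def[abs_def] wide_eq[abs_def]
    by (intro lipschitz_primitive_add lipschitz_primitive_cmult lipschitz_primitive_square
        lipschitz_primitive_const lipschitz_primitive_trunc lipschitz_primitive_trunc_square) auto
  then show ?thesis by simp
qed

lemma line_bounds:
  assumes "0 \<le> x" "x \<le> 1"
  shows "0 \<le> line_weight x" "line_weight x \<le> 1/4"
proof -
  have "0 \<le> line_weight x \<and> line_weight x \<le> 1/4"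
  proof (cases "x \<le> 7/25")
    case True
    then have "x\<^sup>2 \<le> (7/25)\<^sup>2" using assms by (intro power_mono) auto
    then show ?thesis using True by (simp add: line_weight_def bent_def power2_eq_square)
  next
    case False
    have "0 \<le> (x - 7/25) * (1 - x)" using assms False by simp
    then have "x\<^sup>2 \<le> 32/25 * x - 7/25" by (simp add: field_simps power2_eq_square)
    moreover have "0 \<le> (x - 2/3)\<^sup>2" by simp
    then have "4/3 * x - 4/9 \<le> x\<^sup>2" by (simp add: field_simps power2_eq_square)
    ultimately show ?thesis using False assms by (simp add: line_weight_def bent_def)
  qed
  then show "0 \<le> line_weight x" "line_weight x \<le> 1/4" by auto
qed

lemma dent_le: "0 \<le> x \<Longrightarrow> dent x \<le> 21/500"
proof -
  assume "0 \<le> x"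
  then have "max (3/50 - x) 0 \<le> 3/50" by (simp add: max_def)
  moreover from this have "(max (3/50 - x) 0)\<^sup>2 \<le> (3/50)\<^sup>2" by (intro power_mono) auto
  ultimately show ?thesis unfolding dent_def by (simp add: power2_eq_square)
qed

lemma wide_bounds:
  assumes "0 \<le> u" "u \<le> 1"
  shows "0 \<le> wide_weight u" "wide_weight u \<le> 1/2"
proof -
  have d: "0 \<le> dent \<bar>u - 79/200\<bar>" "dent \<bar>u - 79/200\<bar> \<le> 21/500" using dent_nonneg dent_le by auto
  have "0 \<le> wide_weight u \<and> wide_weight u \<le> 1/2"
  proof (cases "u \<le> 79/200")
    case True
    then have "u\<^sup>2 \<le> (79/200)\<^sup>2" using assms by (intro power_mono) auto
    then have "u\<^sup>2 \<le> 6241/40000" by (simp add: power2_eq_square)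
    moreover have "0 \<le> u\<^sup>2" by simp
    moreover have "wide_weight u = 311/1000 + dent \<bar>u - 79/200\<bar> - 3/2 * u\<^sup>2"
      using True by (simp add: wide_weight_def wide_bent_def)
    ultimately show ?thesis using d by linarith
  next
    case False
    have "0 \<le> (u - 79/200) * (1 - u)" using assms False by simp
    then have "u\<^sup>2 \<le> 279/200 * u - 79/200" by (simp add: field_simps power2_eq_square)
    moreover have "0 \<le> (u - 2/3)\<^sup>2" by simp
    then have "4/3 * u - 4/9 \<le> u\<^sup>2" by (simp add: field_simps power2_eq_square)
    ultimately show ?thesis using False assms d by (simp add: wide_weight_def wide_bent_def)
  qed
  then show "0 \<le> wide_weight u" "wide_weight u \<le> 1/2" by auto
qed

lemma line_parallelogram:
  fixes u v :: real
  shows "line_weight (u + v) + line_weight \<bar>u - v\<bar> = bent (u + v) + bent \<bar>u - v\<bar> - 3/2 * u\<^sup>2 - 3/2 * v\<^sup>2"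
  by (simp add: line_weight_def power2_eq_square algebra_simps)

lemma admissible_line_weight: "admissible line_weight (\<lambda>e. if e = e0 then narrow_weight else wide_weight) (1/2)"
  unfolding admissible_def
proof (intro conjI allI impI)
  fix u v :: real and e
  assume uv: "0 \<le> u \<and> 0 \<le> v \<and> u + v \<le> 1"
  have N: "line_weight (u + v) + line_weight \<bar>u - v\<bar> \<le> narrow_weight u + narrow_weight v"
    using bent_le_narrow[of u v] by (simp add: line_parallelogram narrow_weight_def)
  have W: "line_weight (u + v) + line_weight \<bar>u - v\<bar> \<le> wide_weight u + wide_weight v"
    using bent_le_wide_bent[of u v] uv by (simp add: line_parallelogram wide_weight_def)
  show "line_weight (u + v) + line_weight \<bar>u - v\<bar>
      \<le> (if e = e0 then narrow_weight else wide_weight) u + (if e = e0 then narrow_weight else wide_weight) v"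
    using N W by simp
  have half: "line_weight (u + v) + line_weight \<bar>u - v\<bar> \<le> 1/2"
    using line_bounds(2)[of "u + v"] line_bounds(2)[of "\<bar>u - v\<bar>"] uv by (auto simp: abs_if)
  have pos: "0 \<le> (if e = e0 then narrow_weight else wide_weight) w" if "0 \<le> w" "w \<le> 1" for w e
    using wide_bounds(1)[OF that] by (simp add: narrow_weight_def)
  show "line_weight (u + v) + line_weight \<bar>u - v\<bar> \<le> (if e = e0 then narrow_weight else wide_weight) u + 1/2"
    using half pos[of u e] uv by linarith
  show "0 \<le> (if True = e0 then narrow_weight else wide_weight) u + (if False = e0 then narrow_weight else wide_weight) v"
    using pos[of u True] pos[of v False] uv by linarith
  show "line_weight (u + v) + line_weight \<bar>u - v\<bar> \<le> 2 * (1/2)" using half by simp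
qed (use line_bounds in auto)

text \<open>
  The constant \<open>2\<close> would do for \<open>\<Phi>\<close> on the unit interval; the slightly larger one also dominates the
  weights up to a ratio a little above \<open>1\<close>, which is not excluded at this stage.
\<close>

lemma admissible_square: "admissible (\<lambda>x. x\<^sup>2) (\<lambda>e u. 2 * u\<^sup>2) (201/100)"
  unfolding admissible_def
proof (intro conjI allI impI)
  fix u v :: real and e :: bool
  assume uv: "0 \<le> u \<and> 0 \<le> v \<and> u + v \<le> 1"
  have eq: "(u + v)\<^sup>2 + \<bar>u - v\<bar>\<^sup>2 = 2 * u\<^sup>2 + 2 * v\<^sup>2" by (simp add: power2_eq_square algebra_simps)
  have le: "u\<^sup>2 \<le> 1" "v\<^sup>2 \<le> 1" using uv by (auto intro!: power_le_one)
  show "(u + v)\<^sup>2 + \<bar>u - v\<bar>\<^sup>2 \<le> 2 * u\<^sup>2 + 2 * v\<^sup>2" using eq by simp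
  show "(u + v)\<^sup>2 + \<bar>u - v\<bar>\<^sup>2 \<le> 2 * u\<^sup>2 + 201/100" using eq le by simp
  show "(u + v)\<^sup>2 + \<bar>u - v\<bar>\<^sup>2 \<le> 2 * (201/100)" using eq le by simp
qed auto

lemma admissible_co_square: "admissible (\<lambda>x. 1 + - 1 * x\<^sup>2) (\<lambda>e u. 1 + - 2 * u\<^sup>2) 1"
  unfolding admissible_def
proof (intro conjI allI impI)
  fix u v :: real and e :: bool
  assume uv: "0 \<le> u \<and> 0 \<le> v \<and> u + v \<le> 1"
  have eq: "(1 + - 1 * (u + v)\<^sup>2) + (1 + - 1 * \<bar>u - v\<bar>\<^sup>2) = 2 - 2 * u\<^sup>2 - 2 * v\<^sup>2"
    by (simp add: power2_eq_square algebra_simps)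
  have sq: "0 \<le> u\<^sup>2" "0 \<le> v\<^sup>2" by auto
  have "(u + v)\<^sup>2 \<le> 1" "0 \<le> u * v" using uv by (auto intro!: power_le_one)
  then have le: "u\<^sup>2 + v\<^sup>2 \<le> 1" by (simp add: power2_eq_square algebra_simps)
  show "(1 + - 1 * (u + v)\<^sup>2) + (1 + - 1 * \<bar>u - v\<bar>\<^sup>2) \<le> (1 + - 2 * u\<^sup>2) + (1 + - 2 * v\<^sup>2)"
    unfolding eq by simp
  show "(1 + - 1 * (u + v)\<^sup>2) + (1 + - 1 * \<bar>u - v\<bar>\<^sup>2) \<le> (1 + - 2 * u\<^sup>2) + 1"
    unfolding eq using sq by simp
  show "(1 + - 1 * (u + v)\<^sup>2) + (1 + - 1 * \<bar>u - v\<bar>\<^sup>2) \<le> 2 * 1"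
    unfolding eq using sq by simp
  show "0 \<le> (1 + - 2 * u\<^sup>2) + (1 + - 2 * v\<^sup>2)" using le by simp
next
  fix x :: real assume "0 \<le> x \<and> x \<le> 1"
  then show "0 \<le> 1 + - 1 * x\<^sup>2" by (simp add: power_le_one)
qed

section \<open>Covers with few queens\<close>

text \<open>
  The right side is the tangent at \<open>79/100\<close>, close to the larger critical ratio. Together with the next
  lemma it makes the final contradiction one of linear arithmetic.
\<close>

lemma tangent_bound_wide_primitive:
  assumes "91/200 \<le> s"
  shows "2 * wide_primitive s \<le> 314711/1000000 + 3297/10000 * (s - 79/100)"
proof -
  have "314711/1000000 + 3297/10000 * (s - 79/100) - 2 * wide_primitive s = (s - 79/100)\<^sup>2 * (s - 21/50)"
    using assms by (simp add: wide_primitive_def max_absorb1 power2_eq_square power3_eq_cube field_simps)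
  also have "\<dots> \<ge> 0" using assms by (intro mult_nonneg_nonneg) auto
  finally show ?thesis by simp
qed

lemma chord_bound_cube:
  fixes t :: real
  assumes "21/100 \<le> t" "t \<le> 213/1000"
  shows "7/3 * t ^ 3 \<le> 21609/1000000 + 313131/1000000 * (t - 21/100)"
proof -
  have "0 \<le> (t - 21/100) * ((213/1000 - t) * (t + 423/1000))" using assms by simp
  then show ?thesis by (simp add: power3_eq_cube field_simps)
qed

locale small_cover = covered_board +
  assumes m_large: "200000 \<le> m" and small: "card C \<le> 8001/8000 * real m"
begin

lemma ratio_nonneg: "0 \<le> ratio e"
  by (simp add: ratio_def)

lemma density_le: "card C / m \<le> 8001/8000"
  using small m_pos by (simp add: divide_simps)

lemma ratio_sum_ge: "7999/8000 \<le> ratio True + ratio False"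
proof -
  have "2 * real m \<le> real (radius True) + real (radius False) + card C"
    using radius_sum_ge by linarith
  then have "7999/8000 * real m \<le> real (radius True) + real (radius False)" using small by linarith
  then show ?thesis using m_pos by (simp add: ratio_def add_divide_distrib[symmetric] pos_le_divide_eq)
qed

lemma ratio_sum_le: "ratio True + ratio False \<le> 10002/10000"
proof -
  have "real (radius True) + real (radius False) \<le> card C + 2"
    using radius_sum_le by linarith
  then have "real (radius True) + real (radius False) \<le> 10002/10000 * real m"
    using small m_large by linarith
  then show ?thesis using m_pos by (simp add: ratio_def add_divide_distrib[symmetric] pos_divide_le_eq)
qed

lemma ratio_squares: "(ratio True)\<^sup>2 + (ratio False)\<^sup>2 \<le> 1001/1000"
proof -
  have "(ratio True + ratio False)\<^sup>2 \<le> (10002/10000)\<^sup>2"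
    using ratio_sum_le ratio_nonneg by (intro power_mono) auto
  moreover have "0 \<le> ratio True * ratio False" using ratio_nonneg by simp
  ultimately show ?thesis by (simp add: power2_eq_square algebra_simps)
qed

lemma error_small: "X / m \<le> X / 200000" if "0 \<le> X"
  using that m_large by (intro divide_left_mono) auto

lemma ratio_cubes_ge: "499/1000 \<le> ratio True ^ 3 + ratio False ^ 3"
proof -
  let ?a = "ratio True" and ?b = "ratio False"
  define E where "E = 2 * (2 * 1 + \<bar>1\<^sup>2\<bar>) + 2 * (\<Sum>e\<in>UNIV. \<bar>2\<bar> * (2 * ratio e) * ratio e + \<bar>2 * (ratio e)\<^sup>2\<bar>) + 4 * (201/100)"
  have "2 * (1 ^ 3 / 3) \<le> 2 * (2 * (?a ^ 3 / 3)) + 2 * (2 * (?b ^ 3 / 3))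
      + 2 * (201/100) * (card C / m - ?a - ?b)
      + E / m"
    unfolding E_def
  proof (rule integrated_count[where H = "\<lambda>x. x ^ 3 / 3" and h = "\<lambda>x. x\<^sup>2" and \<phi> = "\<lambda>e u. 2 * u\<^sup>2"
        and F = "\<lambda>e u. 2 * (u ^ 3 / 3)" and L' = "\<lambda>e. \<bar>2\<bar> * (2 * ratio e)"])
    show "lipschitz_primitive (ratio e) (\<bar>2\<bar> * (2 * ratio e)) (\<lambda>u. 2 * (u ^ 3 / 3)) (\<lambda>u. 2 * u\<^sup>2)" for e
      by (intro lipschitz_primitive_cmult lipschitz_primitive_square ratio_nonneg)
    show "lipschitz_primitive 1 (2 * 1) (\<lambda>x. x ^ 3 / 3) (\<lambda>x. x\<^sup>2)"
      by (rule lipschitz_primitive_square) simp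
    fix e x assume x: "0 \<le> x" "x \<le> ratio e"
    have "ratio e \<le> 10002/10000" using ratio_sum_le ratio_nonneg[of True] ratio_nonneg[of False] by (cases e) auto
    then have "x\<^sup>2 \<le> (10002/10000)\<^sup>2" using x by (intro power_mono) auto
    then show "2 * x\<^sup>2 \<le> 201/100" by (simp add: power2_eq_square)
  qed (use admissible_square in auto)
  moreover have "E / m \<le> 40 / real m"
    unfolding E_def using ratio_squares by (intro divide_right_mono) (auto simp: UNIV_bool power2_eq_square)
  moreover have "40 / real m \<le> 40 / 200000" by (rule error_small) simp
  ultimately show ?thesis using density_le ratio_sum_ge unfolding power_one by argo
qed

lemma ratio_cubes_le: "ratio True ^ 3 + ratio False ^ 3 \<le> 501/1000"
proof -
  let ?a = "ratio True" and ?b = "ratio False"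
  define E where "E = 2 * (0 + \<bar>- 1\<bar> * (2 * 1) + \<bar>1 + - 1 * 1\<^sup>2\<bar>)
         + 2 * (\<Sum>e\<in>UNIV. (0 + \<bar>- 2\<bar> * (2 * ratio e)) * ratio e + \<bar>1 + - 2 * (ratio e)\<^sup>2\<bar>) + 4 * 1"
  have "2 * (1 * 1 + - 1 * (1 ^ 3 / 3)) \<le> 2 * (1 * ?a + - 2 * (?a ^ 3 / 3)) + 2 * (1 * ?b + - 2 * (?b ^ 3 / 3))
      + 2 * 1 * (card C / m - ?a - ?b)
      + E / m"
    unfolding E_def
  proof (rule integrated_count[where H = "\<lambda>x. 1 * x + - 1 * (x ^ 3 / 3)" and h = "\<lambda>x. 1 + - 1 * x\<^sup>2"
        and \<phi> = "\<lambda>e u. 1 + - 2 * u\<^sup>2" and F = "\<lambda>e u. 1 * u + - 2 * (u ^ 3 / 3)"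
        and L' = "\<lambda>e. 0 + \<bar>- 2\<bar> * (2 * ratio e)"])
    show "lipschitz_primitive 1 (0 + \<bar>- 1\<bar> * (2 * 1)) (\<lambda>x. 1 * x + - 1 * (x ^ 3 / 3)) (\<lambda>x. 1 + - 1 * x\<^sup>2)"
      by (intro lipschitz_primitive_add lipschitz_primitive_const lipschitz_primitive_cmult
          lipschitz_primitive_square) simp
    show "lipschitz_primitive (ratio e) (0 + \<bar>- 2\<bar> * (2 * ratio e))
        (\<lambda>u. 1 * u + - 2 * (u ^ 3 / 3)) (\<lambda>u. 1 + - 2 * u\<^sup>2)" for e
      by (intro lipschitz_primitive_add lipschitz_primitive_const lipschitz_primitive_cmult
          lipschitz_primitive_square ratio_nonneg)
  qed (use admissible_co_square in auto)
  moreover have abs_le: "\<bar>1 + - 2 * (ratio e)\<^sup>2\<bar> \<le> 1 + 2 * (ratio e)\<^sup>2" for e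
    using zero_le_power2[of "ratio e"] unfolding abs_le_iff by linarith
  have "E / m \<le> 40 / real m"
    unfolding E_def using ratio_squares abs_le[of True] abs_le[of False]
    by (intro divide_right_mono) (auto simp: UNIV_bool power2_eq_square)
  moreover have "40 / real m \<le> 40 / 200000" by (rule error_small) simp
  ultimately show ?thesis using density_le ratio_sum_ge unfolding power_one by argo
qed

text \<open>
  With \<open>s\<close> the sum of the two ratios, the sum of their cubes is \<open>s (s^2 - 3 t (s - t))\<close>, which is
  decreasing in \<open>t \<le> s/2\<close>; for \<open>s = 1\<close> it takes the value \<open>1/2\<close> at \<open>t = (3 - sqrt 3)/6\<close>.
\<close>

lemma smaller_ratio:
  assumes "ratio e \<le> ratio (\<not> e)"
  shows "21/100 \<le> ratio e" "ratio e \<le> 213/1000"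
proof -
  define t s where "t = ratio e" and "s = ratio e + ratio (\<not> e)"
  have s: "7999/8000 \<le> s" "s \<le> 10002/10000" and t: "2 * t \<le> s"
    using ratio_sum_ge ratio_sum_le assms unfolding s_def t_def by (cases e; simp)+
  have "ratio True ^ 3 + ratio False ^ 3 = t ^ 3 + (s - t) ^ 3"
    unfolding s_def t_def by (cases e) auto
  also have "\<dots> = s * (s\<^sup>2 - 3 * (t * (s - t)))" by (simp add: power3_eq_cube power2_eq_square algebra_simps)
  finally have cubes: "499/1000 \<le> s * (s\<^sup>2 - 3 * (t * (s - t)))" "s * (s\<^sup>2 - 3 * (t * (s - t))) \<le> 501/1000"
    using ratio_cubes_ge ratio_cubes_le by auto
  show "21/100 \<le> ratio e"
  proof (rule ccontr)
    assume "\<not> ?thesis"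
    then have lt: "t < 21/100" by (simp add: t_def)
    have "0 \<le> (21/100 - t) * (s - 21/100 - t)" using lt s by (intro mult_nonneg_nonneg) auto
    then have "t * (s - t) \<le> 21/100 * (s - 21/100)" by (simp add: algebra_simps)
    moreover have "0 \<le> (s - 1)\<^sup>2" by simp
    then have "2 * s - 1 \<le> s\<^sup>2" by (simp add: power2_eq_square algebra_simps)
    ultimately have "502/1000 \<le> s\<^sup>2 - 3 * (t * (s - t))" using s by simp
    then have "7999/8000 * (502/1000) \<le> s * (s\<^sup>2 - 3 * (t * (s - t)))" using s by (intro mult_mono) auto
    then show False using cubes(2) by simp
  qed
  show "ratio e \<le> 213/1000"
  proof (rule ccontr)
    assume "\<not> ?thesis"
    then have gt: "213/1000 < t" by (simp add: t_def)
    have "0 \<le> (t - 213/1000) * (s - 213/1000 - t)" using gt s t by (intro mult_nonneg_nonneg) auto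
    then have "213/1000 * (s - 213/1000) \<le> t * (s - t)" by (simp add: algebra_simps)
    moreover have "s\<^sup>2 \<le> 10002/10000 * s"
      unfolding power2_eq_square using s by (intro mult_right_mono) auto
    ultimately have "s\<^sup>2 - 3 * (t * (s - t)) \<le> 498/1000" using s by simp
    then have "s * (s\<^sup>2 - 3 * (t * (s - t))) \<le> s * (498/1000)" using s by (intro mult_left_mono) auto
    then show False using cubes(1) s by linarith
  qed
qed

text \<open>
  The bent weight, with the parabolic diagonal weight for the class of smaller radius and the rounded
  hinge for the other class.
\<close>

lemma no_small_cover: False
proof -
  have "ratio True \<le> ratio (\<not> True) \<or> ratio False \<le> ratio (\<not> False)" by auto
  then obtain e where e: "ratio e \<le> ratio (\<not> e)" by blast
  define t s where "t = ratio e" and "s = ratio (\<not> e)"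
  have t: "21/100 \<le> t" "t \<le> 213/1000" using smaller_ratio[OF e] by (auto simp: t_def)
  have ts: "7999/8000 \<le> t + s" "t + s \<le> 10002/10000"
    using ratio_sum_ge ratio_sum_le by (cases e; simp add: t_def s_def)+
  let ?\<phi> = "\<lambda>e'. if e' = e then narrow_weight else wide_weight"
  let ?F = "\<lambda>e'. if e' = e then (\<lambda>u. 7/2 * (u ^ 3 / 3)) else wide_primitive"
  let ?L = "\<lambda>e'. if e' = e then \<bar>7/2\<bar> * (2 * 1) else 119/5"
  have ratio_le: "ratio e' \<le> 1" for e' using t ts by (cases "e' = e") (auto simp: t_def s_def)
  define E where "E = 2 * (89/10 + \<bar>line_weight 1\<bar>) + 2 * (\<Sum>e'\<in>UNIV. ?L e' * ratio e' + \<bar>?\<phi> e' (ratio e')\<bar>) + 4 * (1/2)"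
  have main: "2 * line_primitive 1 \<le> 2 * ?F True (ratio True) + 2 * ?F False (ratio False)
      + 2 * (1/2) * (card C / m - ratio True - ratio False) + E / m"
    unfolding E_def
  proof (rule integrated_count[where L' = ?L])
    show "admissible line_weight ?\<phi> (1/2)" by (rule admissible_line_weight)
    show "lipschitz_primitive 1 (89/10) line_primitive line_weight" by (rule line_primitive)
    fix e'
    have "lipschitz_primitive 1 (\<bar>7/2\<bar> * (2 * 1)) (\<lambda>u. 7/2 * (u ^ 3 / 3)) narrow_weight"
      unfolding narrow_weight_def[abs_def] by (intro lipschitz_primitive_cmult lipschitz_primitive_square) simp
    then have "lipschitz_primitive 1 (?L e') (?F e') (?\<phi> e')" using wide_primitive by simp
    then show "lipschitz_primitive (ratio e') (?L e') (?F e') (?\<phi> e')"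
      by (rule lipschitz_primitive_mono) (rule ratio_le)
    fix x assume x: "0 \<le> x" "x \<le> ratio e'"
    show "?\<phi> e' x \<le> 1/2"
    proof (cases "e' = e")
      case True
      then have "x\<^sup>2 \<le> (213/1000)\<^sup>2" using x t by (intro power_mono) (auto simp: t_def)
      then show ?thesis using True by (simp add: narrow_weight_def power2_eq_square)
    next
      case False
      then show ?thesis using x ratio_le[of e'] wide_bounds(2)[of x] by simp
    qed
  qed simp
  have main': "2 * line_primitive 1 \<le> 7/3 * t ^ 3 + 2 * wide_primitive s + (card C / m - t - s) + E / m"
    using main by (cases e) (simp_all add: t_def s_def)
  have E: "E = 2 * (89/10 + \<bar>line_weight 1\<bar>) + 2 * (7 * t + \<bar>narrow_weight t\<bar> + (119/5 * s + \<bar>wide_weight s\<bar>)) + 2"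
    by (cases e) (simp_all add: t_def s_def E_def UNIV_bool)
  have "t\<^sup>2 \<le> (213/1000)\<^sup>2" using t by (intro power_mono) auto
  then have "\<bar>narrow_weight t\<bar> \<le> 1" by (simp add: narrow_weight_def power2_eq_square)
  moreover have "\<bar>line_weight 1\<bar> \<le> 1/4" using line_bounds[of 1] by simp
  moreover have "\<bar>wide_weight s\<bar> \<le> 1/2" using wide_bounds[of s] t ts by auto
  ultimately have "E \<le> 65" unfolding E using t ts by argo
  have "0 \<le> E" unfolding E using t ts by simp
  then have "E / m \<le> 65 / 200000" using error_small[of E] \<open>E \<le> 65\<close> by linarith
  moreover have "2 * line_primitive 1 = 6323/18750"
    by (simp add: line_primitive_def power2_eq_square power3_eq_cube)
  moreover have "2 * wide_primitive s \<le> 314711/1000000 + 3297/10000 * (s - 79/100)"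
    using t ts by (intro tangent_bound_wide_primitive) auto
  moreover have "7/3 * t ^ 3 \<le> 21609/1000000 + 313131/1000000 * (t - 21/100)"
    using t by (rule chord_bound_cube)
  ultimately show False using main' density_le t ts by argo
qed

end

theorem theorem2p1:
  fixes n :: nat and p :: int and C :: "square set"
  assumes "n \<ge> 400001" and "odd n" and "p \<in> {0, 1}"
    and "p_cover n p C"
  shows "real (card C) > 8001 / 16000 * (real n - 1) - 1 \<and>
    (occupies C (diff_diagonal n 0) \<and> occupies C (sum_diagonal n 0) \<longrightarrow>
       real (card C) > 8001 / 16000 * (real n - 1))"
proof -
  obtain m where m: "n = 2 * m + 1" using assms(2) by (elim oddE)
  have "8001 / 8000 * real m < card C"
  proof (rule ccontr)
    assume "\<not> ?thesis"
    then interpret small_cover n m p C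
      using assms(1,4) m by unfold_locales auto
    show False by (rule no_small_cover)
  qed
  then show ?thesis by (simp add: m)
qed

end
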